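(* Let $F$ be an algebraically closed field of characteristic different from $2$ and $3$, and let $\mathbb{M}$ be the simple non-Lie Malcev algebra over $F$. Let $(\mathbb{M},\Delta)$ be a Malcev bialgebra such that the radical $R$ of the Drinfeld double $D(\mathbb{M})$ is non-zero. Then there exists an element $r\in(\mathrm{id}-\tau)(\mathbb{M}\otimes\mathbb{M})$ such that $\Delta=\Delta_r$ and $r$ is a solution to the classical Yang-Baxter equation $C_{\mathbb{M}}(r)=0$ on $\mathbb{M}$.
   Context: A Malcev algebra is an anticommutative algebra satisfying $J(x,y,xz)=J(x,y,z)x$, where $J(x,y,z)=(xy)z+(yz)x+(zx)y$. The algebra $\mathbb{M}$ is, up to isomorphism, the unique simple non-Lie Malcev algebra over $F$; it is $7$-dimensional with a (standard) basis $h,x,x',y,y',z,z'$ and anticommutative multiplication $hx=2x,\ hy=2y,\ hz=2z,\ hx'=-2x',\ hy'=-2y',\ hz'=-2z',\ xx'=yy'=zz'=h,\ xy=2z',\ yz=2x',\ zx=2y',\ x'y'=-2z,\ y'z'=-2x,\ z'x'=-2y$, other products of basis elements (not determined by anticommutativity) being zero. $\tau$ is the flip $\tau(u\otimes v)=v\otimes u$. For $r=\sum_i a_i\otimes b_i\in \mathbb{M}\otimes \mathbb{M}$: $\Delta_r(a)=\sum_i (a_ia\otimes b_i-a_i\otimes ab_i)$ and $C_{\mathbb{M}}(r)=\sum_{i,j}(a_ia_j\otimes b_i\otimes b_j-a_i\otimes a_jb_i\otimes b_j+a_i\otimes a_j\otimes b_ib_j)$. Malcev bialgebra: given an algebra $A$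 with a linear map $\Delta:A\to A\otimes A$, $\Delta(a)=\sum a_{(1)}\otimes a_{(2)}$, the dual algebra is $A^*$ with product $\langle fg,a\rangle=\sum\langle f,a_{(1)}\rangle\langle g,a_{(2)}\rangle$. The Drinfeld double is $D(A)=A\oplus A^*$ with product $(a+f)(b+g)=(ab+f\rightharpoonup b+a\leftharpoonup g)+(fg+f\leftharpoondown b+a\rightharpoondown g)$, where $f\rightharpoonup a=\sum a_{(1)}\langle f,a_{(2)}\rangle$, $a\leftharpoonup f=\sum\langle f,a_{(1)}\rangle a_{(2)}$, $\langle f\leftharpoondown a,b\rangle=\langle f,ab\rangle$, $\langle b\rightharpoondown f,a\rangle=\langle f,ab\rangle$. For a Malcev algebra $M$ with comultiplication $\Delta$, $(M,\Delta)$ is a Malcev bialgebra if $D(M)$ is a Malcev algebra. The radical means the solvable radical (largest solvable ideal). *)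

theory Defs
  imports "HOL-Analysis.Analysis" "HOL-Computational_Algebra.Polynomial"
begin

section \<open>Nonassociative algebras over a field\<close>

definition bilinear_product ::
  "('a::field \<Rightarrow> 'v \<Rightarrow> 'v) \<Rightarrow> ('v::ab_group_add \<Rightarrow> 'v \<Rightarrow> 'v) \<Rightarrow> bool" where
  "bilinear_product scl mul \<longleftrightarrow>
     (\<forall>x. Vector_Spaces.linear scl scl (mul x)) \<and>
     (\<forall>y. Vector_Spaces.linear scl scl (\<lambda>x. mul x y))"

definition jacobian :: "('v::ab_group_add \<Rightarrow> 'v \<Rightarrow> 'v) \<Rightarrow> 'v \<Rightarrow> 'v \<Rightarrow> 'v \<Rightarrow> 'v" where
  "jacobian mul x y z = mul (mul x y) z + mul (mul y z) x + mul (mul z x) y"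

definition malcev_algebra ::
  "('a::field \<Rightarrow> 'v \<Rightarrow> 'v) \<Rightarrow> ('v::ab_group_add \<Rightarrow> 'v \<Rightarrow> 'v) \<Rightarrow> bool" where
  "malcev_algebra scl mul \<longleftrightarrow>
     bilinear_product scl mul \<and>
     (\<forall>x y. mul x y = - mul y x) \<and>
     (\<forall>x y z. jacobian mul x y (mul x z) = mul (jacobian mul x y z) x)"

definition algebra_ideal ::
  "('a::field \<Rightarrow> 'v \<Rightarrow> 'v) \<Rightarrow> ('v::ab_group_add \<Rightarrow> 'v \<Rightarrow> 'v) \<Rightarrow> 'v set \<Rightarrow> bool" where
  "algebra_ideal scl mul I \<longleftrightarrow>
     module.subspace scl I \<and> (\<forall>x\<in>I. \<forall>y. mul x y \<in> I \<and> mul y x \<in> I)"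

primrec derived_series ::
  "('a::field \<Rightarrow> 'v \<Rightarrow> 'v) \<Rightarrow> ('v::ab_group_add \<Rightarrow> 'v \<Rightarrow> 'v) \<Rightarrow> 'v set \<Rightarrow> nat \<Rightarrow> 'v set" where
  "derived_series scl mul I 0 = I"
| "derived_series scl mul I (Suc n) =
     module.span scl
       {mul x y | x y. x \<in> derived_series scl mul I n \<and> y \<in> derived_series scl mul I n}"

definition solvable_ideal ::
  "('a::field \<Rightarrow> 'v \<Rightarrow> 'v) \<Rightarrow> ('v::ab_group_add \<Rightarrow> 'v \<Rightarrow> 'v) \<Rightarrow> 'v set \<Rightarrow> bool" where
  "solvable_ideal scl mul I \<longleftrightarrow>
     algebra_ideal scl mul I \<and> (\<exists>n. derived_series scl mul I n = {0})"

definition is_radical ::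
  "('a::field \<Rightarrow> 'v \<Rightarrow> 'v) \<Rightarrow> ('v::ab_group_add \<Rightarrow> 'v \<Rightarrow> 'v) \<Rightarrow> 'v set \<Rightarrow> bool" where
  "is_radical scl mul R \<longleftrightarrow>
     solvable_ideal scl mul R \<and> (\<forall>I. solvable_ideal scl mul I \<longrightarrow> I \<subseteq> R)"


section \<open>Tensor squares and comultiplications\<close>

text \<open>
  A finite-dimensional algebra \<open>A\<close> with a basis indexed by \<open>'n\<close> is the coordinate space
  \<open>'a ^ 'n\<close> with a product.  Then \<open>A \<otimes> A\<close> is \<open>'a ^ ('n \<times> 'n)\<close>, the coordinate at \<open>(i, j)\<close> being
  the coefficient of \<open>e\<^sub>i \<otimes> e\<^sub>j\<close>, and similarly for \<open>A \<otimes> A \<otimes> A\<close>.  The dual space is identified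
  with \<open>'a ^ 'n\<close> via the dual basis, so that the pairing is \<open>scalar_product\<close>.
\<close>

abbreviation basis_vec :: "'n::finite \<Rightarrow> ('a::field) ^ 'n" where
  "basis_vec i \<equiv> axis i 1"

definition tensor :: "('a::field) ^ ('n::finite) \<Rightarrow> 'a ^ ('m::finite) \<Rightarrow> 'a ^ ('n \<times> 'm)" (infixr "\<otimes>\<^sub>t" 71) where
  "u \<otimes>\<^sub>t v = (\<chi> p. u $ fst p * v $ snd p)"

definition flip :: "('a::field) ^ ('n::finite \<times> 'n) \<Rightarrow> 'a ^ ('n \<times> 'n)" where
  "flip t = (\<chi> p. t $ (snd p, fst p))"

definition functional :: "(('a::field) ^ ('n::finite) \<Rightarrow> 'a) \<Rightarrow> 'a ^ 'n" where
  "functional \<phi> = (\<chi> i. \<phi> (basis_vec i))"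

text \<open>
  The linear maps \<open>u \<otimes> v \<mapsto> \<langle>f, u\<rangle> v\<close>, \<open>u \<otimes> v \<mapsto> \<langle>f, v\<rangle> u\<close> and \<open>u \<otimes> v \<mapsto> \<langle>f, u\<rangle> \<langle>g, v\<rangle>\<close>.
\<close>

definition contract_fst :: "('a::field) ^ ('n::finite) \<Rightarrow> 'a ^ ('n \<times> 'n) \<Rightarrow> 'a ^ 'n" where
  "contract_fst f t = (\<chi> j. \<Sum>i\<in>UNIV. f $ i * t $ (i, j))"

definition contract_snd :: "('a::field) ^ ('n::finite) \<Rightarrow> 'a ^ ('n \<times> 'n) \<Rightarrow> 'a ^ 'n" where
  "contract_snd f t = (\<chi> i. \<Sum>j\<in>UNIV. f $ j * t $ (i, j))"

definition contract_both :: "('a::field) ^ ('n::finite) \<Rightarrow> 'a ^ 'n \<Rightarrow> 'a ^ ('n \<times> 'n) \<Rightarrow> 'a" where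
  "contract_both f g t = (\<Sum>i\<in>UNIV. \<Sum>j\<in>UNIV. f $ i * g $ j * t $ (i, j))"

lemma scalar_product_functional:
  assumes "Vector_Spaces.linear (*s) (*) \<phi>"
  shows "scalar_product (functional \<phi>) a = \<phi> a"
proof -
  interpret Vector_Spaces.linear "(*s)" "(*)" \<phi> by fact
  have "\<phi> a = \<phi> (\<Sum>i\<in>UNIV. a $ i *s basis_vec i)"
    by (simp add: basis_expansion)
  also have "\<dots> = scalar_product (functional \<phi>) a"
    by (simp add: sum scale scalar_product_def functional_def mult.commute)
  finally show ?thesis by simp
qed

lemma contract_tensor:
  "contract_fst f (u \<otimes>\<^sub>t v) = scalar_product f u *s v"
  "contract_snd f (u \<otimes>\<^sub>t v) = scalar_product f v *s u"
  "contract_both f g (u \<otimes>\<^sub>t v) = scalar_product f u * scalar_product g v"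
  subgoal by (simp add: contract_fst_def tensor_def scalar_product_def vec_eq_iff
      sum_distrib_left sum_distrib_right mult_ac)
  subgoal by (simp add: contract_snd_def tensor_def scalar_product_def vec_eq_iff
      sum_distrib_left sum_distrib_right mult_ac)
  subgoal by (simp only: contract_both_def tensor_def scalar_product_def sum_product)
      (simp add: mult_ac)
  done

lemma flip_tensor: "flip (u \<otimes>\<^sub>t v) = v \<otimes>\<^sub>t u"
  by (simp add: flip_def tensor_def vec_eq_iff mult.commute)

lemma tensor_expansion:
  "t = (\<Sum>p\<in>UNIV. t $ p *s (basis_vec (fst p) \<otimes>\<^sub>t basis_vec (snd p)))"
proof -
  have "basis_vec (fst p) \<otimes>\<^sub>t basis_vec (snd p) = (basis_vec p :: 'a ^ ('b \<times> 'c))" for p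
    by (auto simp: tensor_def axis_def vec_eq_iff prod_eq_iff)
  then show ?thesis by (simp add: basis_expansion)
qed


section \<open>The Drinfeld double and Malcev bialgebras\<close>

definition dual_mult ::
  "(('a::field) ^ ('n::finite) \<Rightarrow> 'a ^ ('n \<times> 'n)) \<Rightarrow> 'a ^ 'n \<Rightarrow> 'a ^ 'n \<Rightarrow> 'a ^ 'n" where
  "dual_mult \<Delta> f g = functional (\<lambda>a. contract_both f g (\<Delta> a))"

text \<open>
  The four actions \<open>f \<rightharpoonup> a\<close>, \<open>a \<leftharpoonup> f\<close> (with values in \<open>A\<close>) and \<open>f \<leftharpoondown> a\<close>, \<open>a \<rightharpoondown> f\<close> (with values in
  the dual).
\<close>

definition dual_act_left ::
  "(('a::field) ^ ('n::finite) \<Rightarrow> 'a ^ ('n \<times> 'n)) \<Rightarrow> 'a ^ 'n \<Rightarrow> 'a ^ 'n \<Rightarrow> 'a ^ 'n" where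
  "dual_act_left \<Delta> f a = contract_snd f (\<Delta> a)"

definition dual_act_right ::
  "(('a::field) ^ ('n::finite) \<Rightarrow> 'a ^ ('n \<times> 'n)) \<Rightarrow> 'a ^ 'n \<Rightarrow> 'a ^ 'n \<Rightarrow> 'a ^ 'n" where
  "dual_act_right \<Delta> a f = contract_fst f (\<Delta> a)"

definition coadj_right ::
  "(('a::field) ^ ('n::finite) \<Rightarrow> 'a ^ 'n \<Rightarrow> 'a ^ 'n) \<Rightarrow> 'a ^ 'n \<Rightarrow> 'a ^ 'n \<Rightarrow> 'a ^ 'n" where
  "coadj_right mul f a = functional (\<lambda>b. scalar_product f (mul a b))"

definition coadj_left ::
  "(('a::field) ^ ('n::finite) \<Rightarrow> 'a ^ 'n \<Rightarrow> 'a ^ 'n) \<Rightarrow> 'a ^ 'n \<Rightarrow> 'a ^ 'n \<Rightarrow> 'a ^ 'n" where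
  "coadj_left mul b f = functional (\<lambda>a. scalar_product f (mul a b))"

abbreviation double_scale :: "'a::field \<Rightarrow> ('a ^ 'n) \<times> ('a ^ 'n) \<Rightarrow> ('a ^ 'n) \<times> ('a ^ 'n)" where
  "double_scale \<equiv> module_prod.scale (*s) (*s)"

text \<open>The pair \<open>(a, f)\<close> stands for \<open>a + f\<close>.\<close>

definition double_mult ::
  "(('a::field) ^ ('n::finite) \<Rightarrow> 'a ^ 'n \<Rightarrow> 'a ^ 'n) \<Rightarrow> ('a ^ 'n \<Rightarrow> 'a ^ ('n \<times> 'n)) \<Rightarrow>
    ('a ^ 'n) \<times> ('a ^ 'n) \<Rightarrow> ('a ^ 'n) \<times> ('a ^ 'n) \<Rightarrow> ('a ^ 'n) \<times> ('a ^ 'n)" where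
  "double_mult mul \<Delta> = (\<lambda>(a, f) (b, g).
     (mul a b + dual_act_left \<Delta> f b + dual_act_right \<Delta> a g,
      dual_mult \<Delta> f g + coadj_right mul f b + coadj_left mul a g))"

definition malcev_bialgebra ::
  "(('a::field) ^ ('n::finite) \<Rightarrow> 'a ^ 'n \<Rightarrow> 'a ^ 'n) \<Rightarrow> ('a ^ 'n \<Rightarrow> 'a ^ ('n \<times> 'n)) \<Rightarrow> bool" where
  "malcev_bialgebra mul \<Delta> \<longleftrightarrow>
     malcev_algebra (*s) mul \<and> Vector_Spaces.linear (*s) (*s) \<Delta> \<and>
     malcev_algebra double_scale (double_mult mul \<Delta>)"


section \<open>Coboundary comultiplications and the classical Yang--Baxter equation\<close>

text \<open>
  Both formulas use the decomposition of \<open>r\<close> along the basis \<open>e\<^sub>i \<otimes> e\<^sub>j\<close>; the lemmas below show that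
  every other decomposition gives the same result.
\<close>

definition coboundary ::
  "(('a::field) ^ ('n::finite) \<Rightarrow> 'a ^ 'n \<Rightarrow> 'a ^ 'n) \<Rightarrow> 'a ^ ('n \<times> 'n) \<Rightarrow> 'a ^ 'n \<Rightarrow> 'a ^ ('n \<times> 'n)" where
  "coboundary mul r a = (\<Sum>(i, j)\<in>UNIV. r $ (i, j) *s
     (mul (basis_vec i) a \<otimes>\<^sub>t basis_vec j - basis_vec i \<otimes>\<^sub>t mul a (basis_vec j)))"

definition cybe ::
  "(('a::field) ^ ('n::finite) \<Rightarrow> 'a ^ 'n \<Rightarrow> 'a ^ 'n) \<Rightarrow> 'a ^ ('n \<times> 'n) \<Rightarrow> 'a ^ ('n \<times> 'n \<times> 'n)" where
  "cybe mul r = (\<Sum>(i, j)\<in>UNIV. \<Sum>(k, l)\<in>UNIV. (r $ (i, j) * r $ (k, l)) *s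
     (mul (basis_vec i) (basis_vec k) \<otimes>\<^sub>t basis_vec j \<otimes>\<^sub>t basis_vec l
      - basis_vec i \<otimes>\<^sub>t mul (basis_vec k) (basis_vec j) \<otimes>\<^sub>t basis_vec l
      + basis_vec i \<otimes>\<^sub>t basis_vec k \<otimes>\<^sub>t mul (basis_vec j) (basis_vec l)))"

text \<open>
  Any map on simple tensors \<open>\<beta>\<close> that is bilinear may be evaluated on any decomposition.
\<close>

lemma decomposition_independent:
  fixes \<beta> :: "('a::field) ^ ('n::finite) \<Rightarrow> 'a ^ ('m::finite) \<Rightarrow> 'a ^ 'k" and u :: "'i \<Rightarrow> 'a ^ 'n"
  assumes L: "\<And>v. Vector_Spaces.linear (*s) (*s) (\<lambda>u. \<beta> u v)"
    and R: "\<And>u. Vector_Spaces.linear (*s) (*s) (\<beta> u)"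
    and r: "r = (\<Sum>s\<in>S. u s \<otimes>\<^sub>t v s)"
  shows "(\<Sum>(i, j)\<in>UNIV. r $ (i, j) *s \<beta> (basis_vec i) (basis_vec j)) = (\<Sum>s\<in>S. \<beta> (u s) (v s))"
proof -
  have expand: "\<beta> x y = (\<Sum>(i, j)\<in>UNIV. (x $ i * y $ j) *s \<beta> (basis_vec i) (basis_vec j))" for x y
  proof -
    interpret l: Vector_Spaces.linear "(*s)" "(*s)" "\<lambda>u. \<beta> u y" by (rule L)
    have "\<beta> x y = (\<Sum>i\<in>UNIV. x $ i *s \<beta> (basis_vec i) y)"
      by (subst basis_expansion[of x, symmetric]) (simp only: l.sum l.scale)
    also have "\<dots> = (\<Sum>i\<in>UNIV. \<Sum>j\<in>UNIV. (x $ i * y $ j) *s \<beta> (basis_vec i) (basis_vec j))"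
    proof (rule sum.cong[OF refl])
      fix i
      interpret r: Vector_Spaces.linear "(*s)" "(*s)" "\<beta> (basis_vec i)" by (rule R)
      show "x $ i *s \<beta> (basis_vec i) y =
          (\<Sum>j\<in>UNIV. (x $ i * y $ j) *s \<beta> (basis_vec i) (basis_vec j))"
        by (subst basis_expansion[of y, symmetric])
          (simp only: r.sum r.scale vec.scale_sum_right vec.scale_scale)
    qed
    finally show ?thesis by (simp add: sum.cartesian_product)
  qed
  have "(\<Sum>(i, j)\<in>UNIV. r $ (i, j) *s \<beta> (basis_vec i) (basis_vec j)) =
      (\<Sum>p\<in>UNIV. \<Sum>s\<in>S. (u s $ fst p * v s $ snd p) *s \<beta> (basis_vec (fst p)) (basis_vec (snd p)))"
    by (simp add: r tensor_def case_prod_unfold vec.scale_sum_left)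
  also have "\<dots> = (\<Sum>s\<in>S. \<beta> (u s) (v s))"
    by (subst sum.swap) (simp add: expand[of "u _" "v _"] case_prod_unfold)
  finally show ?thesis .
qed

lemma coboundary_decomposition:
  fixes mul :: "('a::field) ^ ('n::finite) \<Rightarrow> 'a ^ 'n \<Rightarrow> 'a ^ 'n"
  assumes mul: "bilinear_product (*s) mul" and r: "r = (\<Sum>s\<in>S. u s \<otimes>\<^sub>t v s)"
  shows "coboundary mul r a = (\<Sum>s\<in>S. mul (u s) a \<otimes>\<^sub>t v s - u s \<otimes>\<^sub>t mul a (v s))"
proof -
  have lin: "mul (x + y) z = mul x z + mul y z" "mul x (y + z) = mul x y + mul x z"
      "mul (c *s x) y = c *s mul x y" "mul x (c *s y) = c *s mul x y" for x y z c
    using mul by (auto simp: bilinear_product_def Vector_Spaces.linear_iff)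
  show ?thesis
    unfolding coboundary_def
    by (rule decomposition_independent[OF _ _ r, where \<beta> = "\<lambda>u v. mul u a \<otimes>\<^sub>t v - u \<otimes>\<^sub>t mul a v"])
      (unfold_locales; simp add: lin tensor_def vec_eq_iff algebra_simps)+
qed

lemma cybe_decomposition:
  fixes mul :: "('a::field) ^ ('n::finite) \<Rightarrow> 'a ^ 'n \<Rightarrow> 'a ^ 'n"
  assumes mul: "bilinear_product (*s) mul" and r: "r = (\<Sum>s\<in>S. u s \<otimes>\<^sub>t v s)"
  shows "cybe mul r = (\<Sum>s\<in>S. \<Sum>t\<in>S.
     mul (u s) (u t) \<otimes>\<^sub>t v s \<otimes>\<^sub>t v t - u s \<otimes>\<^sub>t mul (u t) (v s) \<otimes>\<^sub>t v t
     + u s \<otimes>\<^sub>t u t \<otimes>\<^sub>t mul (v s) (v t))"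
proof -
  have lin: "mul (x + y) z = mul x z + mul y z" "mul x (y + z) = mul x y + mul x z"
      "mul (c *s x) y = c *s mul x y" "mul x (c *s y) = c *s mul x y" for x y z c
    using mul by (auto simp: bilinear_product_def Vector_Spaces.linear_iff)
  define \<gamma> where "\<gamma> = (\<lambda>a b a' b'. mul a a' \<otimes>\<^sub>t b \<otimes>\<^sub>t b' - a \<otimes>\<^sub>t mul a' b \<otimes>\<^sub>t b' + a \<otimes>\<^sub>t a' \<otimes>\<^sub>t mul b b')"
  have inner: "(\<Sum>(k, l)\<in>UNIV. r $ (k, l) *s \<gamma> a b (basis_vec k) (basis_vec l)) =
      (\<Sum>t\<in>S. \<gamma> a b (u t) (v t))" for a b
    by (rule decomposition_independent[OF _ _ r])
      (unfold_locales; simp add: \<gamma>_def lin tensor_def vec_eq_iff algebra_simps)+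
  have add: "\<gamma> (a + a') b c d = \<gamma> a b c d + \<gamma> a' b c d" "\<gamma> a (b + b') c d = \<gamma> a b c d + \<gamma> a b' c d"
    and sc: "\<gamma> (z *s a) b c d = z *s \<gamma> a b c d" "\<gamma> a (z *s b) c d = z *s \<gamma> a b c d"
    for a a' b b' c d z
    by (simp_all add: \<gamma>_def lin tensor_def vec_eq_iff algebra_simps)
  have "cybe mul r = (\<Sum>(i, j)\<in>UNIV. r $ (i, j) *s
      (\<Sum>(k, l)\<in>UNIV. r $ (k, l) *s \<gamma> (basis_vec i) (basis_vec j) (basis_vec k) (basis_vec l)))"
    by (simp add: cybe_def \<gamma>_def case_prod_unfold vec.scale_sum_right)
  also have "\<dots> = (\<Sum>(i, j)\<in>UNIV. r $ (i, j) *s (\<Sum>t\<in>S. \<gamma> (basis_vec i) (basis_vec j) (u t) (v t)))"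
    by (simp only: inner)
  also have "\<dots> = (\<Sum>s\<in>S. \<Sum>t\<in>S. \<gamma> (u s) (v s) (u t) (v t))"
    by (rule decomposition_independent[OF _ _ r])
      (unfold_locales; simp add: add sc sum.distrib vec.scale_sum_right)+
  finally show ?thesis by (simp add: \<gamma>_def)
qed


section \<open>The simple non-Lie Malcev algebra\<close>

datatype mbasis = H | X | X' | Y | Y' | Z | Z'

lemma UNIV_mbasis: "(UNIV :: mbasis set) = {H, X, X', Y, Y', Z, Z'}"
  by (auto intro: mbasis.exhaust)

instance mbasis :: finite
  by standard (simp only: UNIV_mbasis finite_insert finite.emptyI)

fun mbasis_table :: "mbasis \<Rightarrow> mbasis \<Rightarrow> ('a::field) ^ mbasis" where
  "mbasis_table H X = 2 *s basis_vec X"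
| "mbasis_table H Y = 2 *s basis_vec Y"
| "mbasis_table H Z = 2 *s basis_vec Z"
| "mbasis_table H X' = - 2 *s basis_vec X'"
| "mbasis_table H Y' = - 2 *s basis_vec Y'"
| "mbasis_table H Z' = - 2 *s basis_vec Z'"
| "mbasis_table X X' = basis_vec H"
| "mbasis_table Y Y' = basis_vec H"
| "mbasis_table Z Z' = basis_vec H"
| "mbasis_table X Y = 2 *s basis_vec Z'"
| "mbasis_table Y Z = 2 *s basis_vec X'"
| "mbasis_table Z X = 2 *s basis_vec Y'"
| "mbasis_table X' Y' = - 2 *s basis_vec Z"
| "mbasis_table Y' Z' = - 2 *s basis_vec X"
| "mbasis_table Z' X' = - 2 *s basis_vec Y"
| "mbasis_table _ _ = 0"

text \<open>
  The table contains at most one of the products \<open>e\<^sub>i e\<^sub>j\<close> and \<open>e\<^sub>j e\<^sub>i\<close>, so antisymmetrising it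
  yields the anticommutative product it determines.
\<close>

definition M_mult :: "('a::field) ^ mbasis \<Rightarrow> 'a ^ mbasis \<Rightarrow> 'a ^ mbasis" where
  "M_mult u v = (\<Sum>i\<in>UNIV. \<Sum>j\<in>UNIV. (u $ i * v $ j) *s (mbasis_table i j - mbasis_table j i))"

end

theory Submission
  imports Defs
begin

text \<open>
  The proof rests on the simplicity of the algebra \<open>A\<close> and on the associativity of the canonical
  pairing on \<open>D(A) = A \<oplus> A\<^sup>*\<close>.  The ideal \<open>R \<inter> A\<close> vanishes since \<open>A\<close>
  is perfect and \<open>R\<close> is solvable, and the projection of \<open>R\<close> to \<open>A\<^sup>*\<close> is onto since the
  coadjoint module is irreducible; so \<open>R\<close> is the graph \<open>{T f + f}\<close> of a map \<open>T : A\<^sup>* \<rightarrow> A\<close>.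
  By irreducibility again the pairing restricted to \<open>R\<close> is non-degenerate or zero.  If it is
  non-degenerate, then \<open>D(A) = R + R\<^sup>\<bottom>\<close> with \<open>R\<^sup>\<bottom> R = 0\<close>, hence \<open>R R \<supseteq> A R\<close> is all of \<open>R\<close>,
  against solvability.  So \<open>R\<close> is isotropic: \<open>T\<close> is skew and corresponds to a skew tensor \<open>r\<close>.
  Now \<open>A R \<subseteq> R\<close> says that \<open>\<Delta> = \<Delta>\<^sub>r\<close>, and \<open>R R \<subseteq> R \<inter> D(A)\<^sup>\<bottom> = 0\<close> is the Yang--Baxter equation.
\<close>

section \<open>Duality between a coordinate space and itself\<close>

lemma scalar_product_simps:
  fixes f g a b :: "('a::field) ^ ('n::finite)"
  shows "scalar_product (f + g) a = scalar_product f a + scalar_product g a"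
    "scalar_product f (a + b) = scalar_product f a + scalar_product f b"
    "scalar_product (c *s f) a = c * scalar_product f a"
    "scalar_product f (c *s a) = c * scalar_product f a"
    "scalar_product (- f) a = - scalar_product f a"
    "scalar_product f (- a) = - scalar_product f a"
    "scalar_product (f - g) a = scalar_product f a - scalar_product g a"
    "scalar_product f (a - b) = scalar_product f a - scalar_product f b"
    "scalar_product 0 a = 0"
    "scalar_product f 0 = 0"
  by (simp_all add: scalar_product_def algebra_simps sum.distrib sum_distrib_left sum_negf
      sum_subtractf)

lemma scalar_product_commute: "scalar_product f a = scalar_product (a::('a::field) ^ 'n) f"
  by (simp add: scalar_product_def mult.commute)

lemma scalar_product_basis [simp]:
  "scalar_product f (basis_vec i) = (f::('a::field) ^ ('n::finite)) $ i"
  by (simp add: scalar_product_def axis_def if_distrib[of "\<lambda>x. _ * x"] cong: if_cong)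

lemma sum_basis_mult [simp]:
  "(\<Sum>s\<in>UNIV. (basis_vec s :: ('a::field) ^ ('n::finite)) $ i * g s) = g i"
  by (simp add: axis_def if_distrib[of "\<lambda>x. x * _"] cong: if_cong)

lemma scalar_product_eqI:
  fixes f g :: "('a::field) ^ ('n::finite)"
  assumes "\<And>a. scalar_product f a = scalar_product g a"
  shows "f = g"
  using assms[of "basis_vec _"] by (simp add: vec_eq_iff)

lemma scalar_product_contract:
  fixes f g :: "('a::field) ^ ('n::finite)"
  shows "scalar_product g (contract_fst f t) = contract_both f g t"
    and "scalar_product f (contract_snd g t) = contract_both f g t"
proof -
  show "scalar_product g (contract_fst f t) = contract_both f g t"
    unfolding scalar_product_def contract_fst_def contract_both_def
    by (subst sum.swap) (simp add: sum_distrib_left mult_ac)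
  show "scalar_product f (contract_snd g t) = contract_both f g t"
    unfolding scalar_product_def contract_snd_def contract_both_def
    by (simp add: sum_distrib_left mult_ac)
qed

text \<open>A basis of \<open>W\<close> stays independent after adding a vector outside
  \<open>W\<close>, so a linear form can be prescribed as 0 on the basis and 1 on that
  vector.\<close>

lemma exists_annihilating_functional:
  fixes W :: "(('a::field) ^ ('n::finite)) set"
  assumes W: "vec.subspace W" and "W \<noteq> UNIV"
  obtains f where "f \<noteq> 0" "\<And>w. w \<in> W \<Longrightarrow> scalar_product f w = 0"
proof -
  interpret vector_space_pair "(*s) :: 'a \<Rightarrow> 'a ^ 'n \<Rightarrow> 'a ^ 'n" "(*) :: 'a \<Rightarrow> 'a \<Rightarrow> 'a"
    by unfold_locales (auto simp: algebra_simps)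
  obtain b where b: "b \<notin> W" using \<open>W \<noteq> UNIV\<close> by auto
  obtain B where B: "B \<subseteq> W" "vec.independent B" "W \<subseteq> vec.span B"
    using vec.maximal_independent_subset[of W] by blast
  then have span: "vec.span B = W" using vec.span_subspace W by blast
  have "b \<notin> B" using b B by blast
  moreover have "vec.independent (insert b B)"
    using vec.independent_insertI[of b B] B b span by simp
  ultimately obtain \<phi> where \<phi>: "Vector_Spaces.linear (*s) (*) \<phi>"
    "\<And>x. x \<in> insert b B \<Longrightarrow> \<phi> x = (if x = b then 1 else 0)"
    using linear_independent_extend[of "insert b B" "\<lambda>x. if x = b then 1 else 0"] by blast
  have zero: "\<phi> w = 0" if "w \<in> W" for w
  proof (rule linear_eq_0_on_span[OF \<phi>(1)])
    show "w \<in> vec.span B" using that span by simp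
    show "\<phi> x = 0" if "x \<in> B" for x using that \<phi>(2)[of x] \<open>b \<notin> B\<close> by auto
  qed
  have "scalar_product (functional \<phi>) b = 1"
    using scalar_product_functional[OF \<phi>(1)] \<phi>(2) by simp
  then have "functional \<phi> \<noteq> 0"
    by (auto simp: scalar_product_simps)
  then show ?thesis
    using that zero scalar_product_functional[OF \<phi>(1)] by metis
qed

section \<open>The double of a simple anticommutative algebra and its canonical form\<close>

interpretation double: vector_space_prod
  "(*s) :: 'a::field \<Rightarrow> 'a ^ 'n \<Rightarrow> 'a ^ 'n" "(*s) :: 'a::field \<Rightarrow> 'a ^ 'n \<Rightarrow> 'a ^ 'n"
  by unfold_locales

text \<open>The assumption \<open>nontrivial\<close> excludes the one-dimensional algebra with zero
  product, which satisfies \<open>simple\<close>; it is what makes the algebra perfect.\<close>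

locale simple_anticommutative_double =
  fixes mul :: "('a::field) ^ ('n::finite) \<Rightarrow> 'a ^ 'n \<Rightarrow> 'a ^ 'n"
    and \<Delta> :: "'a ^ 'n \<Rightarrow> 'a ^ ('n \<times> 'n)"
  assumes bilinear: "bilinear_product (*s) mul"
    and linear_comult: "Vector_Spaces.linear (*s) (*s) \<Delta>"
    and double_bilinear: "bilinear_product double_scale (double_mult mul \<Delta>)"
    and double_anticomm: "double_mult mul \<Delta> u v = - double_mult mul \<Delta> v u"
    and simple: "algebra_ideal (*s) mul I \<Longrightarrow> I = {0} \<or> I = UNIV"
    and nontrivial: "\<exists>x y. mul x y \<noteq> 0"
begin

lemma mul_simps [simp]:
  "mul (x + y) z = mul x z + mul y z" "mul x (y + z) = mul x y + mul x z"
  "mul (c *s x) y = c *s mul x y" "mul x (c *s y) = c *s mul x y"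
  using bilinear by (auto simp: bilinear_product_def Vector_Spaces.linear_iff)

lemma comult_simps [simp]: "\<Delta> (x + y) = \<Delta> x + \<Delta> y" "\<Delta> (c *s x) = c *s \<Delta> x"
  using linear_comult by (auto simp: Vector_Spaces.linear_iff)

lemma mul_zero [simp]: "mul 0 y = 0" "mul x 0 = 0"
  using mul_simps(3)[of 0 0 y] mul_simps(4)[of x 0 0] by simp_all

abbreviation dmul (infixl "\<star>" 70) where "u \<star> v \<equiv> double_mult mul \<Delta> u v"

lemma dmul_simps [simp]:
  "(u + v) \<star> w = u \<star> w + v \<star> w" "u \<star> (v + w) = u \<star> v + u \<star> w"
  "double_scale c u \<star> v = double_scale c (u \<star> v)" "u \<star> double_scale c v = double_scale c (u \<star> v)"
  using double_bilinear by (simp_all add: bilinear_product_def Vector_Spaces.linear_iff del: split_paired_All)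

lemma dmul_minus [simp]: "(- u) \<star> v = - (u \<star> v)" "u \<star> (- v) = - (u \<star> v)"
  using dmul_simps(3)[of "-1" u v] dmul_simps(4)[of u "-1" v]
  by (simp_all add: double.p.scale_minus_left)

lemma dmul_diff [simp]: "(u - v) \<star> w = u \<star> w - v \<star> w" "u \<star> (v - w) = u \<star> v - u \<star> w"
  using dmul_simps(1)[of u "- v" w] dmul_simps(2)[of u v "- w"] by simp_all

lemma scalar_product_dual_mult: "scalar_product (dual_mult \<Delta> f g) a = contract_both f g (\<Delta> a)"
  unfolding dual_mult_def
  by (rule scalar_product_functional)
     (auto simp: Vector_Spaces.linear_iff contract_both_def algebra_simps sum.distrib
        sum_distrib_left vector_space_def module_def intro!: vec.vector_space_axioms vector_space.intro)

lemma scalar_product_coadj: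
  "scalar_product (coadj_right mul f a) b = scalar_product f (mul a b)"
  "scalar_product (coadj_left mul b f) a = scalar_product f (mul a b)"
  unfolding coadj_right_def coadj_left_def
  by (rule scalar_product_functional; unfold_locales; simp add: scalar_product_simps algebra_simps)+

definition pairing :: "('a ^ 'n) \<times> ('a ^ 'n) \<Rightarrow> ('a ^ 'n) \<times> ('a ^ 'n) \<Rightarrow> 'a" where
  "pairing u v = scalar_product (snd u) (fst v) + scalar_product (snd v) (fst u)"

lemma pairing_simps:
  "pairing (u + v) w = pairing u w + pairing v w" "pairing u (v + w) = pairing u v + pairing u w"
  "pairing (u - v) w = pairing u w - pairing v w" "pairing u (v - w) = pairing u v - pairing u w"
  "pairing (- u) v = - pairing u v" "pairing u (- v) = - pairing u v"
  "pairing (double_scale c u) v = c * pairing u v" "pairing u (double_scale c v) = c * pairing u v"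
  "pairing 0 v = 0"
  by (simp_all add: pairing_def scalar_product_simps double.scale_def algebra_simps)

text \<open>For u = (a, f), v = (b, g), w = (c, h) the four actions are adjoint to the two products,
  and the left side expands to f(bc) + g(ca) + h(ab) plus the values of (f, g) on
  \<open>\<Delta> c\<close>, of (g, h) on \<open>\<Delta> a\<close> and of (h, f) on
  \<open>\<Delta> b\<close>. This is invariant under cyclic rotation of the three factors, and the
  form is symmetric.\<close>

lemma pairing_assoc: "pairing (u \<star> v) w = pairing u (v \<star> w)"
  by (cases u; cases v; cases w)
    (simp add: pairing_def double_mult_def scalar_product_simps scalar_product_dual_mult
      scalar_product_coadj dual_act_left_def dual_act_right_def scalar_product_contract
      scalar_product_commute[of _ "contract_fst _ _"])

lemma dmul_embed:
  "(a, 0) \<star> (b, 0) = (mul a b, 0)"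
  "(a, 0) \<star> (0, g) = (contract_fst g (\<Delta> a), coadj_left mul a g)"
  "(0, f) \<star> (b, 0) = (contract_snd f (\<Delta> b), coadj_right mul f b)"
  by (simp_all add: double_mult_def dual_act_left_def dual_act_right_def contract_fst_def
      contract_snd_def dual_mult_def contract_both_def coadj_left_def coadj_right_def
      functional_def scalar_product_simps vec_eq_iff)

lemma dmul_embed_left:
  "(a, 0) \<star> (b, g) = (mul a b + contract_fst g (\<Delta> a), coadj_left mul a g)"
  using dmul_simps(2)[of "(a, 0)" "(b, 0)" "(0, g)"] by (simp add: dmul_embed del: dmul_simps)

lemma mul_anticomm: "mul a b = - mul b a"
  using double_anticomm[of "(a, 0)" "(b, 0)"] by (simp add: dmul_embed)

text \<open>The algebra component of anticommutativity, taken for a functional and a vector: the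
  comultiplication has skew values.\<close>

lemma contract_snd_comult: "contract_snd f (\<Delta> a) = - contract_fst f (\<Delta> a)"
  using double_anticomm[of "(0, f)" "(a, 0)"] by (simp add: dmul_embed)

text \<open>The span contains every product, so it is an ideal, and it is not zero.\<close>

lemma perfect: "vec.span {mul x y | x y. True} = UNIV"
proof -
  have "algebra_ideal (*s) mul (vec.span {mul x y | x y. True})"
    by (auto simp: algebra_ideal_def intro: vec.span_base)
  moreover have "vec.span {mul x y | x y. True} \<noteq> {0}"
    using nontrivial vec.span_superset[of "{mul x y | x y. True}"] by blast
  ultimately show ?thesis using simple by blast
qed

text \<open>The annihilator of a coadjoint submodule is an ideal of the algebra, and simplicity
  leaves two cases: annihilator zero, which forces the whole dual, or annihilator everything, which
  forces zero.\<close>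

lemma coadjoint_irreducible:
  assumes N: "vec.subspace N" and inv: "\<And>a f. f \<in> N \<Longrightarrow> coadj_left mul a f \<in> N"
  shows "N = {0} \<or> N = UNIV"
proof (cases "N = UNIV")
  case False
  define I where "I = {a. \<forall>f\<in>N. scalar_product f a = 0}"
  have "scalar_product f (mul a b) = 0" if "a \<in> I" "f \<in> N" for a b f
    using that inv[OF that(2), of b] by (simp add: I_def flip: scalar_product_coadj(2))
  moreover from this have "scalar_product f (mul b a) = 0" if "a \<in> I" "f \<in> N" for a b f
    using that by (subst mul_anticomm) (simp add: scalar_product_simps)
  moreover have "vec.subspace I"
    by (auto simp: I_def vec.subspace_def scalar_product_simps)
  ultimately have "algebra_ideal (*s) mul I"
    by (simp add: algebra_ideal_def I_def)
  then have "I = {0} \<or> I = UNIV" by (rule simple)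
  moreover have "I \<noteq> {0}"
  proof -
    \<comment> \<open>The roles of the space and its dual are exchanged: the functional that
      annihilates \<open>N\<close> is read as a vector of the algebra.\<close>
    obtain b where "b \<noteq> 0" "\<And>f. f \<in> N \<Longrightarrow> scalar_product b f = 0"
      using exists_annihilating_functional[OF N False] by blast
    then have "b \<in> I" by (simp add: I_def scalar_product_commute[of _ b])
    with \<open>b \<noteq> 0\<close> show ?thesis by blast
  qed
  ultimately have "scalar_product f a = 0" if "f \<in> N" for f a
    using that by (auto simp: I_def)
  then have "f = 0" if "f \<in> N" for f
    using that by (intro scalar_product_eqI) (simp add: scalar_product_simps)
  then show ?thesis using vec.subspace_0[OF N] by blast
qed simp

lemma coadjoint_nontrivial: "\<exists>a f. coadj_left mul a f \<noteq> 0"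
proof (rule ccontr)
  assume "\<not> ?thesis"
  then have "scalar_product f (mul b a) = 0" for a b f
    using scalar_product_coadj(2)[of a f b] by (simp add: scalar_product_simps)
  then have "mul b a = 0" for a b
    by (intro scalar_product_eqI) (simp add: scalar_product_commute scalar_product_simps)
  then show False using nontrivial by blast
qed

text \<open>This is how solvability is refuted: a set spanned by its own products survives in every
  term of the derived series. It is applied to the copy of the algebra in the double and to the
  whole solvable ideal.\<close>

lemma perfect_subset_derived_series:
  assumes "J \<subseteq> double.p.span {u \<star> v | u v. u \<in> J \<and> v \<in> J}" "J \<subseteq> I"
  shows "J \<subseteq> derived_series double_scale (double_mult mul \<Delta>) I n"
proof (induction n)
  case (Suc n)
  then have "{u \<star> v | u v. u \<in> J \<and> v \<in> J} \<subseteq> {u \<star> v | u v.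
    u \<in> derived_series double_scale (double_mult mul \<Delta>) I n \<and>
    v \<in> derived_series double_scale (double_mult mul \<Delta>) I n}" by blast
  from subset_trans[OF assms(1) double.p.span_mono[OF this]] show ?case
    unfolding derived_series.simps .
qed (use assms in simp)

end

section \<open>A non-zero solvable ideal as an isotropic graph\<close>

locale solvable_ideal_in_double = simple_anticommutative_double mul \<Delta>
  for mul :: "('a::field) ^ ('n::finite) \<Rightarrow> 'a ^ 'n \<Rightarrow> 'a ^ 'n" and \<Delta> +
  fixes R :: "(('a ^ 'n) \<times> ('a ^ 'n)) set"
  assumes solvable: "solvable_ideal double_scale (double_mult mul \<Delta>) R"
    and nonzero: "R \<noteq> {0}"
begin

lemma subspace_R: "double.p.subspace R"
  and ideal_R: "u \<in> R \<Longrightarrow> u \<star> v \<in> R" "u \<in> R \<Longrightarrow> v \<star> u \<in> R"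
  using solvable by (simp_all add: solvable_ideal_def algebra_ideal_def del: split_paired_All)

lemmas R_closed = double.p.subspace_0[OF subspace_R] double.p.subspace_add[OF subspace_R]
  double.p.subspace_scale[OF subspace_R] double.p.subspace_diff[OF subspace_R]

lemma no_perfect_subset:
  assumes "J \<subseteq> double.p.span {u \<star> v | u v. u \<in> J \<and> v \<in> J}" "J \<subseteq> R"
  shows "J \<subseteq> {0}"
  using perfect_subset_derived_series[OF assms] solvable
  unfolding solvable_ideal_def by metis

lemma R_Int: assumes "(a, 0) \<in> R" shows "a = 0"
proof -
  define I where "I = {a. (a, 0) \<in> R}"
  have "mul a b \<in> I \<and> mul b a \<in> I" if "a \<in> I" for a b
    using ideal_R[of "(a, 0)" "(b, 0)"] that by (simp add: I_def dmul_embed)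
  moreover have "vec.subspace I"
    unfolding vec.subspace_def I_def
    using R_closed(1) R_closed(2)[of "(_, 0)" "(_, 0)"] R_closed(3)[of "(_, 0)"]
    by (auto simp: zero_prod_def double.scale_def)
  ultimately have "I = {0} \<or> I = UNIV"
    by (intro simple) (simp add: algebra_ideal_def)
  moreover have "I \<noteq> UNIV"
  proof
    assume "I = UNIV"
    define J where "J = {(a :: 'a ^ 'n, 0 :: 'a ^ 'n) | a. True}"
    define S where "S = double.p.span {u \<star> v | u v. u \<in> J \<and> v \<in> J}"
    have sub: "double.p.subspace S" by (simp add: S_def)
    \<comment> \<open>The vectors that \<open>S\<close> contains form a subspace with all products
      in it, so by perfectness \<open>S\<close> contains the whole copy \<open>J\<close> of the
      algebra.\<close>
    have "vec.span {mul x y | x y. True} \<subseteq> {a. (a, 0) \<in> S}"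
    proof (rule vec.span_minimal)
      show "vec.subspace {a. (a, 0) \<in> S}"
        unfolding vec.subspace_def
        using double.p.subspace_0[OF sub] double.p.subspace_add[OF sub, of "(_, 0)" "(_, 0)"]
          double.p.subspace_scale[OF sub, of "(_, 0)"]
        by (auto simp: zero_prod_def double.scale_def)
      show "{mul x y | x y. True} \<subseteq> {a. (a, 0) \<in> S}"
        by (force simp: S_def J_def simp flip: dmul_embed(1) intro!: double.p.span_base)
    qed
    then have "J \<subseteq> S" unfolding perfect by (auto simp: J_def)
    then have "J \<subseteq> {0}"
      using no_perfect_subset[of J] \<open>I = UNIV\<close> by (auto simp: S_def J_def I_def)
    moreover have "(x, 0) \<in> J" for x by (simp add: J_def)
    ultimately have "x = 0" for x :: "'a ^ 'n" by (force simp: zero_prod_def)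
    then show False using nontrivial by metis
  qed
  ultimately show ?thesis using assms by (auto simp: I_def)
qed

lemma ex1_R: "\<exists>!a. (a, f) \<in> R"
proof -
  define N where "N = {f. \<exists>a. (a, f) \<in> R}"
  have "coadj_left mul a f \<in> N" if f: "f \<in> N" for a f
  proof -
    obtain b where "(b, f) \<in> R" using f by (auto simp: N_def)
    \<comment> \<open>Multiplying by a vector of the algebra acts on the dual component through
      \<open>coadj_left\<close> alone, so the projection of \<open>R\<close> to the dual is a
      submodule.\<close>
    from ideal_R(2)[OF this, of "(a, 0)"] show ?thesis by (auto simp: N_def dmul_embed_left)
  qed
  moreover have "vec.subspace N"
  proof (rule vec.subspaceI)
    show "0 \<in> N" using R_closed(1) by (auto simp: N_def zero_prod_def)
    show "f + g \<in> N" if "f \<in> N" "g \<in> N" for f g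
      using that R_closed(2)[of "(_, f)" "(_, g)"] unfolding N_def add_Pair by blast
    show "c *s f \<in> N" if "f \<in> N" for c f
      using that R_closed(3)[of "(_, f)" c] unfolding N_def double.scale_prod by blast
  qed
  ultimately have "N = {0} \<or> N = UNIV" by (intro coadjoint_irreducible)
  moreover have "N \<noteq> {0}"
  proof
    assume "N = {0}"
    then have "f = 0" if "(a, f) \<in> R" for a f using that by (auto simp: N_def)
    then have "u = 0" if "u \<in> R" for u
      using that R_Int by (metis prod.collapse zero_prod_def)
    then show False using nonzero R_closed(1) by blast
  qed
  ultimately have "f \<in> N" by blast
  then obtain a where "(a, f) \<in> R" by (auto simp: N_def)
  moreover have "b = a" if "(b, f) \<in> R" for b
    using R_Int[of "b - a"] R_closed(4)[OF that \<open>(a, f) \<in> R\<close>] by simp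
  ultimately show ?thesis by blast
qed

definition T :: "'a ^ 'n \<Rightarrow> 'a ^ 'n" where "T f = (THE a. (a, f) \<in> R)"

lemma R_iff: "(a, f) \<in> R \<longleftrightarrow> a = T f"
  using theI'[OF ex1_R[of f]] ex1_R[of f] unfolding T_def by blast

lemma T_simps [simp]: "T (f + g) = T f + T g" "T (c *s f) = c *s T f" "T 0 = 0"
  using R_closed(2)[of "(T f, f)" "(T g, g)"] R_closed(3)[of "(T f, f)" c] R_closed(1)
  by (simp_all add: R_iff double.scale_def zero_prod_def)

lemma T_expansion: "T f = (\<Sum>i\<in>UNIV. f $ i *s T (basis_vec i))"
proof -
  interpret Vector_Spaces.linear "(*s)" "(*s)" T by unfold_locales simp_all
  show ?thesis by (subst basis_expansion[of f, symmetric]) (simp only: sum scale)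
qed

text \<open>The product of (a, 0) with a point of the graph is again on the graph. Solved for the
  contraction, this expresses the comultiplication through \<open>T\<close>.\<close>

lemma T_coadjoint: "T (coadj_left mul a f) = mul a (T f) + contract_fst f (\<Delta> a)"
  using ideal_R(2)[of "(T f, f)" "(a, 0)"] by (simp add: R_iff dmul_embed_left)

lemma isotropic: assumes "u \<in> R" "v \<in> R" shows "pairing u v = 0"
proof -
  \<comment> \<open>\<open>N\<close> is the kernel of the form restricted to \<open>R\<close>,
    transported to the dual along the graph.\<close>
  define N where "N = {f. \<forall>w\<in>R. pairing (T f, f) w = 0}"
  have eq: "(T (f + g), f + g) = (T f, f) + (T g, g)"
    "(T (c *s f), c *s f) = double_scale c (T f, f)" for f g c
    by (simp_all add: double.scale_def)
  have "vec.subspace N"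
    unfolding vec.subspace_def N_def mem_Collect_eq eq
    by (simp add: pairing_simps flip: zero_prod_def del: add_Pair)
  moreover have "coadj_left mul a f \<in> N" if "f \<in> N" for a f
  proof -
    have "pairing ((a, 0) \<star> (T f, f)) w = 0" if "w \<in> R" for w
    proof -
      \<comment> \<open>Anticommutativity and then associativity of the form move (a, 0) over to
        \<open>w\<close>, and the product stays in \<open>R\<close>.\<close>
      have "pairing ((a, 0) \<star> (T f, f)) w = - pairing ((T f, f) \<star> (a, 0)) w"
        by (subst double_anticomm) (rule pairing_simps)
      also have "\<dots> = 0"
        using \<open>f \<in> N\<close> ideal_R(2)[OF that] by (simp add: pairing_assoc N_def)
      finally show ?thesis .
    qed
    then show ?thesis
      by (simp add: N_def dmul_embed_left T_coadjoint)
  qed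
  ultimately have "N = {0} \<or> N = UNIV" by (rule coadjoint_irreducible)
  moreover have "N \<noteq> {0}"
  proof
    assume N0: "N = {0}"
    \<comment> \<open>\<open>B\<close> is the restricted form seen as a map from the dual to its own
      dual, which is the algebra. Trivial kernel makes it bijective.\<close>
    define B where "B f = functional (\<lambda>g. pairing (T f, f) (T g, g))" for f
    have lin: "Vector_Spaces.linear (*s) (*) (\<lambda>g. pairing (T f, f) (T g, g))" for f
      by unfold_locales
        (simp_all only: eq pairing_simps, simp_all add: algebra_simps)
    have B: "scalar_product (B f) g = pairing (T f, f) (T g, g)" for f g
      unfolding B_def by (rule scalar_product_functional[OF lin])
    have linB: "Vector_Spaces.linear (*s) (*s) B"
      by unfold_locales
        (rule scalar_product_eqI, simp only: B scalar_product_simps eq pairing_simps)+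
    interpret B: Vector_Spaces.linear "(*s)" "(*s)" B by (rule linB)
    have "f = 0" if "B f = 0" for f
    proof -
      have "pairing (T f, f) (T g, g) = 0" for g
        using that by (simp flip: B add: scalar_product_simps)
      then have "f \<in> N" by (auto simp: N_def R_iff)
      then show ?thesis using N0 by simp
    qed
    then have "inj B" by (simp add: B.inj_iff_eq_0)
    then have surj: "surj B" using vec.linear_inj_imp_surj linB by blast
    define S where "S = double.p.span {u \<star> v | u v. u \<in> R \<and> v \<in> R}"
    have mem: "(a, 0) \<star> u \<in> S" if u: "u \<in> R" for a u
    proof -
      \<comment> \<open>With this \<open>f\<close> the elements (a, 0) and (T f, f) pair equally
        with all of \<open>R\<close>, so their difference \<open>w\<close> is orthogonal to
        \<open>R\<close>.\<close>
      obtain f where f: "B f = a" using surj by (metis surjD)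
      define w where "w = (a, 0) - (T f, f)"
      have w: "pairing w v = 0" if "v \<in> R" for v
      proof -
        have v: "v = (T (snd v), snd v)" using that R_iff by (metis prod.collapse)
        have "pairing (a, 0) v = scalar_product (B f) (snd v)"
          by (simp add: pairing_def f scalar_product_simps scalar_product_commute)
        also have "\<dots> = pairing (T f, f) v" by (subst (2) v) (rule B)
        finally show ?thesis by (simp add: w_def pairing_simps del: diff_Pair)
      qed
      have "w \<star> u \<in> R" using u by (rule ideal_R)
      then obtain g where g: "w \<star> u = (T g, g)" by (metis R_iff prod.collapse)
      \<comment> \<open>The product of \<open>w\<close> and \<open>u\<close> lies in
        \<open>R\<close> and is orthogonal to \<open>R\<close>, so non-degeneracy kills it, and (a,
        0) acts on \<open>u\<close> as an element of \<open>R\<close> does.\<close>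
      have "pairing (T g, g) v = 0" if "v \<in> R" for v
        using w[OF ideal_R(2)[OF that]] by (simp flip: g add: pairing_assoc)
      then have "g = 0" using N0 by (auto simp: N_def)
      then have "w \<star> u = 0" using g by (simp add: zero_prod_def)
      then have "(a, 0) \<star> u = (T f, f) \<star> u" by (simp add: w_def del: diff_Pair)
      also have "(T f, f) \<in> R" by (simp add: R_iff)
      then have "(T f, f) \<star> u \<in> S" unfolding S_def
        using u by (intro double.p.span_base) blast
      finally show ?thesis .
    qed
    \<comment> \<open>\<open>K\<close> is the span of the products of \<open>R\<close>, read in the
      dual. It contains the whole image of the coadjoint action, so it is a non-zero submodule,
      hence everything; then \<open>R\<close> is perfect.\<close>
    define K where "K = {f. (T f, f) \<in> S}"
    have K: "coadj_left mul a f \<in> K" for a f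
      using mem[of "(T f, f)" a] by (simp add: K_def R_iff dmul_embed_left T_coadjoint)
    have "double.p.subspace S" by (simp add: S_def)
    then have "vec.subspace K"
      unfolding vec.subspace_def K_def mem_Collect_eq eq
      by (intro conjI allI impI ballI CollectI)
        (simp_all add: double.p.subspace_0 double.p.subspace_add double.p.subspace_scale
          flip: zero_prod_def del: add_Pair)
    then have "K = {0} \<or> K = UNIV" by (rule coadjoint_irreducible) (rule K)
    then have "K = UNIV" using K coadjoint_nontrivial by blast
    then have "R \<subseteq> S" by (auto simp: K_def R_iff)
    then have "R \<subseteq> {0}" using no_perfect_subset[of R] by (simp add: S_def)
    then show False using nonzero R_closed(1) by blast
  qed
  ultimately have "snd u \<in> N" by blast
  moreover have "u = (T (snd u), snd u)" using assms R_iff by (metis prod.collapse)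
  ultimately show ?thesis using assms unfolding N_def by auto
qed

section \<open>The skew tensor of the graph and the Yang-Baxter equation\<close>

lemma T_skew: "scalar_product f (T g) = - scalar_product g (T f)"
  using isotropic[of "(T f, f)" "(T g, g)"]
  by (simp add: R_iff pairing_def eq_neg_iff_add_eq_0)

text \<open>By associativity of the form and isotropy, the product is orthogonal to the algebra,
  which removes its dual component; a point of the graph with zero dual component is zero.\<close>

lemma R_square: assumes "u \<in> R" "v \<in> R" shows "u \<star> v = 0"
proof -
  have R: "u \<star> v \<in> R" using assms by (simp add: ideal_R)
  have "pairing (u \<star> v) (a, 0) = 0" for a
    unfolding pairing_assoc using assms by (intro isotropic ideal_R)
  then have "snd (u \<star> v) = 0"
    by (intro scalar_product_eqI) (simp add: pairing_def scalar_product_simps)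
  moreover have "fst (u \<star> v) = T (snd (u \<star> v))" using R by (simp flip: R_iff)
  ultimately show ?thesis by (simp add: prod_eq_iff)
qed

text \<open>This is the algebra component of the vanishing product of two graph points, up to sign,
  with the comultiplication eliminated by \<open>T_coadjoint\<close>. It is the operator form of the
  Yang-Baxter equation.\<close>

lemma T_yang_baxter:
  "mul (T f) (T g) - T (coadj_left mul (T f) g) + T (coadj_left mul (T g) f) = 0"
proof -
  have "fst ((T f, f) \<star> (T g, g)) = 0" by (subst R_square) (simp_all add: R_iff)
  then have "mul (T f) (T g) - contract_fst f (\<Delta> (T g)) + contract_fst g (\<Delta> (T f)) = 0"
    by (simp add: double_mult_def dual_act_left_def dual_act_right_def contract_snd_comult)
  then show ?thesis
    unfolding T_coadjoint using mul_anticomm[of "T f" "T g"] by (simp add: algebra_simps)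
qed

text \<open>The tensor of \<open>T\<close> under the identification of maps from the dual to the
  algebra with the tensor square: contracting its first factor with f gives T f.\<close>

definition r :: "'a ^ ('n \<times> 'n)" where "r = (\<Sum>i\<in>UNIV. basis_vec i \<otimes>\<^sub>t T (basis_vec i))"

lemma r_nth: "r $ (i, j) = T (basis_vec i) $ j"
  by (simp add: r_def tensor_def)

lemma r_skew: "flip r = - r"
proof -
  have "T (basis_vec j) $ i = - T (basis_vec i) $ j" for i j
    using T_skew[of "basis_vec i" "basis_vec j"]
    by (simp add: scalar_product_commute[of "basis_vec _" "T _"])
  then have "r $ (j, i) = - r $ (i, j)" for i j unfolding r_nth .
  then show ?thesis unfolding flip_def vec_eq_iff vec_lambda_beta vector_uminus_component
    by (metis prod.collapse)
qed

text \<open>The coefficients on the left are the coordinates of the coadjoint image, so the sum is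
  the expansion of \<open>T\<close> at it.\<close>

lemma sum_mul_basis: "(\<Sum>t\<in>UNIV. mul (basis_vec t) a $ p *s T (basis_vec t)) = T (coadj_left mul a (basis_vec p))"
  by (subst T_expansion[of "coadj_left mul a (basis_vec p)"])
    (simp add: coadj_left_def functional_def scalar_product_commute[of "axis _ _"])

text \<open>Fixing the first tensor index p contracts with a basis functional. The two terms of the
  coboundary become those of \<open>T_coadjoint\<close> for that functional.\<close>

lemma comult_coboundary: "\<Delta> = coboundary mul r"
proof
  fix a
  have "\<Delta> a $ (p, q) = coboundary mul r a $ (p, q)" for p q
  proof -
    have "coboundary mul r a $ (p, q) = (\<Sum>i\<in>UNIV. mul (basis_vec i) a $ p *s T (basis_vec i)) $ q
      - mul a (T (basis_vec p)) $ q"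
      unfolding coboundary_decomposition[OF bilinear r_def]
      by (simp add: tensor_def sum_subtractf)
    also have "\<dots> = contract_fst (basis_vec p) (\<Delta> a) $ q"
      unfolding sum_mul_basis T_coadjoint by simp
    also have "\<dots> = \<Delta> a $ (p, q)"
      by (simp add: contract_fst_def axis_def if_distrib[of "\<lambda>x. x * _"] cong: if_cong)
    finally show ?thesis by simp
  qed
  then show "\<Delta> a = coboundary mul r a" by (simp add: vec_eq_iff)
qed

text \<open>Fixing the first two tensor indices p and q evaluates \<open>T_yang_baxter\<close> at
  two basis functionals, one summand for each of its three terms.\<close>

lemma cybe_r: "cybe mul r = 0"
proof -
  have "cybe mul r $ (p, q, k) = 0" for p q k
  proof -
    have expand: "(\<Sum>i\<in>UNIV. x $ i * mul (basis_vec i) y $ p) = mul x y $ p" for x y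
    proof -
      interpret Vector_Spaces.linear "(*s)" "(*s)" "\<lambda>x. mul x y" by unfold_locales simp_all
      show ?thesis
        by (subst (2) basis_expansion[of x, symmetric]) (simp only: sum scale, simp)
    qed
    \<comment> \<open>In the first summand \<open>T\<close> sits in the q slot and is evaluated at
      the summation index. Skewness moves it to q, after which the sum over s collapses to one
      product.\<close>
    have inner: "(\<Sum>s\<in>UNIV. mul (basis_vec s) (basis_vec t) $ p * T (basis_vec s) $ q) =
        mul (basis_vec t) (T (basis_vec q)) $ p" for t
    proof -
      have "T (basis_vec s) $ q = - T (basis_vec q) $ s" for s
        using T_skew[of "basis_vec q" "basis_vec s"]
        by (simp add: scalar_product_commute[of "basis_vec _" "T _"])
      then have "(\<Sum>s\<in>UNIV. mul (basis_vec s) (basis_vec t) $ p * T (basis_vec s) $ q) =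
          - (\<Sum>s\<in>UNIV. T (basis_vec q) $ s * mul (basis_vec s) (basis_vec t) $ p)"
        by (simp add: sum_negf mult.commute)
      also have "\<dots> = - mul (T (basis_vec q)) (basis_vec t) $ p" by (simp only: expand)
      also have "\<dots> = mul (basis_vec t) (T (basis_vec q)) $ p"
        by (subst mul_anticomm[of "basis_vec t"]) simp
      finally show ?thesis .
    qed
    have "cybe mul r $ (p, q, k) =
      (\<Sum>s\<in>UNIV. \<Sum>t\<in>UNIV.
        mul (basis_vec s) (basis_vec t) $ p * T (basis_vec s) $ q * T (basis_vec t) $ k)
      - (\<Sum>s\<in>UNIV. \<Sum>t\<in>UNIV. basis_vec s $ p *
          (mul (basis_vec t) (T (basis_vec s)) $ q * T (basis_vec t) $ k))
      + (\<Sum>s\<in>UNIV. \<Sum>t\<in>UNIV. basis_vec s $ p * (basis_vec t $ q *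
          mul (T (basis_vec s)) (T (basis_vec t)) $ k))"
      unfolding cybe_decomposition[OF bilinear r_def]
      by (simp add: tensor_def sum_subtractf sum.distrib mult.assoc)
    also have "(\<Sum>s\<in>UNIV. \<Sum>t\<in>UNIV.
        mul (basis_vec s) (basis_vec t) $ p * T (basis_vec s) $ q * T (basis_vec t) $ k) =
      (\<Sum>t\<in>UNIV. mul (basis_vec t) (T (basis_vec q)) $ p * T (basis_vec t) $ k)"
      by (subst sum.swap) (simp add: inner flip: sum_distrib_right)
    also have "\<dots> = T (coadj_left mul (T (basis_vec q)) (basis_vec p)) $ k"
      by (simp flip: sum_mul_basis)
    also have "(\<Sum>s\<in>UNIV. \<Sum>t\<in>UNIV. basis_vec s $ p *
          (mul (basis_vec t) (T (basis_vec s)) $ q * T (basis_vec t) $ k)) =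
        T (coadj_left mul (T (basis_vec p)) (basis_vec q)) $ k"
      by (simp flip: sum_distrib_left sum_mul_basis)
    also have "(\<Sum>s\<in>UNIV. \<Sum>t\<in>UNIV. basis_vec s $ p * (basis_vec t $ q *
          mul (T (basis_vec s)) (T (basis_vec t)) $ k)) =
        mul (T (basis_vec p)) (T (basis_vec q)) $ k"
      by (simp flip: sum_distrib_left)
    finally show ?thesis
      using arg_cong[OF T_yang_baxter[of "basis_vec p" "basis_vec q"], of "\<lambda>v. v $ k"]
      by (simp add: algebra_simps)
  qed
  then show ?thesis by (simp add: vec_eq_iff)
qed

end

section \<open>Simplicity of the algebra on seven basis elements\<close>

lemma two_neq_0: "CHAR('a::field) \<noteq> 2 \<Longrightarrow> (2::'a) \<noteq> 0"
proof
  assume "CHAR('a) \<noteq> 2" "(2::'a) = 0"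
  then have "CHAR('a) dvd 2" using of_nat_eq_0_iff_char_dvd[of 2, where 'a='a] by simp
  then have "CHAR('a) = 1 \<or> CHAR('a) = 2"
    using two_is_prime_nat prime_nat_iff by blast
  then show False using \<open>CHAR('a) \<noteq> 2\<close> CHAR_not_1[where 'a='a] by simp
qed

lemma M_mult_nth [simp]:
  fixes u v :: "('a::field) ^ mbasis"
  shows "M_mult u v $ H = u $ X * v $ X' - u $ X' * v $ X + u $ Y * v $ Y' - u $ Y' * v $ Y
      + u $ Z * v $ Z' - u $ Z' * v $ Z"
    "M_mult u v $ X = 2 * (u $ H * v $ X - u $ X * v $ H - u $ Y' * v $ Z' + u $ Z' * v $ Y')"
    "M_mult u v $ Y = 2 * (u $ H * v $ Y - u $ Y * v $ H - u $ Z' * v $ X' + u $ X' * v $ Z')"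
    "M_mult u v $ Z = 2 * (u $ H * v $ Z - u $ Z * v $ H - u $ X' * v $ Y' + u $ Y' * v $ X')"
    "M_mult u v $ X' = 2 * (u $ X' * v $ H - u $ H * v $ X' + u $ Y * v $ Z - u $ Z * v $ Y)"
    "M_mult u v $ Y' = 2 * (u $ Y' * v $ H - u $ H * v $ Y' + u $ Z * v $ X - u $ X * v $ Z)"
    "M_mult u v $ Z' = 2 * (u $ Z' * v $ H - u $ H * v $ Z' + u $ X * v $ Y - u $ Y * v $ X)"
  by (simp_all add: M_mult_def UNIV_mbasis axis_def algebra_simps)

lemma mbasis_vec_eq_iff:
  "(u::'a ^ mbasis) = v \<longleftrightarrow> u $ H = v $ H \<and> u $ X = v $ X \<and> u $ Y = v $ Y \<and> u $ Z = v $ Z \<and>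
    u $ X' = v $ X' \<and> u $ Y' = v $ Y' \<and> u $ Z' = v $ Z'"
proof -
  have "(\<forall>i. P i) \<longleftrightarrow> P H \<and> P X \<and> P Y \<and> P Z \<and> P X' \<and> P Y' \<and> P Z'" for P
    by (metis mbasis.exhaust)
  then show ?thesis unfolding vec_eq_iff .
qed

text \<open>The argument uses the weights of h. The other basis vectors are eigenvectors of h with
  eigenvalue 2 or -2, so an ideal with h in it is everything; and any non-zero element of an ideal
  yields a non-zero multiple of h.\<close>

lemma M_simple:
  fixes I :: "(('a::field) ^ mbasis) set"
  assumes two: "(2::'a) \<noteq> 0" and I: "algebra_ideal (*s) M_mult I"
  shows "I = {0} \<or> I = UNIV"
proof -
  have sub: "vec.subspace I" and mult: "\<And>x y. x \<in> I \<Longrightarrow> M_mult x y \<in> I" "\<And>x y. x \<in> I \<Longrightarrow> M_mult y x \<in> I"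
    using I by (auto simp: algebra_ideal_def)
  have unscale: "x \<in> I" if "c *s x \<in> I" "c \<noteq> 0" for c x
    using vec.subspace_scale[OF sub that(1), of "inverse c"] that(2) by simp
  have eight: "(8::'a) \<noteq> 0"
  proof -
    have "(8::'a) = 2 * (2 * 2)" by simp
    then show ?thesis using two by (metis mult_eq_0_iff)
  qed
  have full: "I = UNIV" if h: "basis_vec H \<in> I"
  proof -
    have "basis_vec i \<in> I" for i
    proof (cases "i = H")
      case False
      obtain c :: 'a where c: "c \<noteq> 0" "M_mult (basis_vec H) (basis_vec i) = c *s basis_vec i"
      proof
        show "(if i \<in> {X, Y, Z} then 2 else - 2 :: 'a) \<noteq> 0" using two by simp
        show "M_mult (basis_vec H) (basis_vec i) =
            (if i \<in> {X, Y, Z} then 2 else - 2 :: 'a) *s basis_vec i"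
          using \<open>i \<noteq> H\<close> by (cases i) (simp_all add: mbasis_vec_eq_iff axis_def)
      qed
      show ?thesis using mult(1)[OF h, of "basis_vec i"] c by (simp add: unscale)
    qed (use h in simp)
    then have "(\<Sum>i\<in>UNIV. v $ i *s basis_vec i) \<in> I" for v
      by (intro vec.subspace_sum[OF sub] vec.subspace_scale[OF sub])
    then show ?thesis by (auto simp: basis_expansion)
  qed
  have "I = UNIV" if w: "w \<in> I" "w \<noteq> 0" for w
  proof -
    define L where "L = M_mult (basis_vec H :: 'a ^ mbasis)"
    \<comment> \<open>\<open>L\<close> acts on the three weight spaces by \<open>0, 2, -2\<close>, so these combinations project \<open>8 w\<close>
      onto the last two.\<close>
    define p where "p = L (L w) + 2 *s L w"
    define n where "n = L (L w) - 2 *s L w"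
    have LI: "L w \<in> I" "L (L w) \<in> I" using w mult by (auto simp: L_def)
    then have pn: "p \<in> I" "n \<in> I"
      unfolding p_def n_def
      using vec.subspace_add[OF sub] vec.subspace_diff[OF sub] vec.subspace_scale[OF sub] by blast+
    \<comment> \<open>Within one weight space, multiplying by the partner in xx' = yy' = zz' = h
      isolates a single coordinate. The sign changes when the primed factor comes first.\<close>
    have pairs: "M_mult p (basis_vec X') = (8 * w $ X) *s basis_vec H"
      "M_mult p (basis_vec Y') = (8 * w $ Y) *s basis_vec H"
      "M_mult p (basis_vec Z') = (8 * w $ Z) *s basis_vec H"
      "M_mult n (basis_vec X) = (- 8 * w $ X') *s basis_vec H"
      "M_mult n (basis_vec Y) = (- 8 * w $ Y') *s basis_vec H"
      "M_mult n (basis_vec Z) = (- 8 * w $ Z') *s basis_vec H"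
      by (simp_all add: p_def n_def L_def mbasis_vec_eq_iff axis_def)
    have mem: "(8 * w $ i) *s basis_vec H \<in> I \<or> (- 8 * w $ i) *s basis_vec H \<in> I" if "i \<noteq> H" for i
      using that mult(1)[OF pn(1), of "basis_vec X'", unfolded pairs]
        mult(1)[OF pn(1), of "basis_vec Y'", unfolded pairs]
        mult(1)[OF pn(1), of "basis_vec Z'", unfolded pairs]
        mult(1)[OF pn(2), of "basis_vec X", unfolded pairs]
        mult(1)[OF pn(2), of "basis_vec Y", unfolded pairs]
        mult(1)[OF pn(2), of "basis_vec Z", unfolded pairs]
      by (cases i) blast+
    show ?thesis
    proof (cases "\<exists>i. i \<noteq> H \<and> w $ i \<noteq> 0")
      case True
      then obtain i where "i \<noteq> H" "w $ i \<noteq> 0" by blast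
      moreover from this have "8 * w $ i \<noteq> 0" "- 8 * w $ i \<noteq> 0" using eight by simp_all
      ultimately show ?thesis using mem[of i] unscale full by blast
    next
      case False
      then have "w $ i = 0" if "i \<noteq> H" for i using that by blast
      then have "w = w $ H *s basis_vec H" by (simp add: mbasis_vec_eq_iff axis_def)
      moreover from this have "w $ H \<noteq> 0" using \<open>w \<noteq> 0\<close> by (metis vec.scale_zero_left)
      ultimately show ?thesis
        using full unscale[of "w $ H" "basis_vec H"] \<open>w \<in> I\<close> by simp
    qed
  qed
  then show ?thesis using vec.subspace_0[OF sub] by blast
qed

section \<open>Application to the Malcev bialgebra\<close>

theorem theorem3:
  fixes \<Delta> :: "('a::alg_closed_field) ^ mbasis \<Rightarrow> 'a ^ (mbasis \<times> mbasis)"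
    and R :: "(('a ^ mbasis) \<times> ('a ^ mbasis)) set"
  assumes "CHAR('a) \<noteq> 2" and "CHAR('a) \<noteq> 3"
    and "malcev_bialgebra M_mult \<Delta>"
    and "is_radical double_scale (double_mult M_mult \<Delta>) R"
    and "R \<noteq> {0}"
  shows "\<exists>r \<in> range (\<lambda>t. t - flip t). \<Delta> = coboundary M_mult r \<and> cybe M_mult r = 0"
proof -
  have two: "(2::'a) \<noteq> 0" using assms(1) by (rule two_neq_0)
  have double: "bilinear_product (*s) (M_mult :: 'a ^ mbasis \<Rightarrow> _)"
    "Vector_Spaces.linear (*s) (*s) \<Delta>"
    "bilinear_product double_scale (double_mult M_mult \<Delta>)"
    "\<And>u v. double_mult M_mult \<Delta> u v = - double_mult M_mult \<Delta> v u"
    using assms(3) unfolding malcev_bialgebra_def malcev_algebra_def by blast+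
  have nontrivial: "\<exists>x y :: 'a ^ mbasis. M_mult x y \<noteq> 0"
    by (rule exI[of _ "basis_vec X"], rule exI[of _ "basis_vec X'"])
      (simp add: mbasis_vec_eq_iff axis_def)
  have solvable: "solvable_ideal double_scale (double_mult M_mult \<Delta>) R"
    using assms(4) unfolding is_radical_def by blast
  interpret solvable_ideal_in_double M_mult \<Delta> R
    by (intro solvable_ideal_in_double.intro simple_anticommutative_double.intro
        solvable_ideal_in_double_axioms.intro)
      (fact double nontrivial M_simple[OF two] solvable assms(5) | assumption)+
  \<comment> \<open>Since \<open>r\<close> is skew, half of it is a preimage under the identity
    minus the flip; characteristic different from 2 allows the halving.\<close>
  have "r = inverse 2 *s r - flip (inverse 2 *s r)"
  proof -
    have "flip (inverse 2 *s r) = - (inverse 2 *s r)"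
    proof -
      have "flip (inverse 2 *s r) = inverse 2 *s flip r" by (simp add: flip_def vec_eq_iff)
      then show ?thesis unfolding r_skew by simp
    qed
    moreover have "inverse 2 *s r + inverse 2 *s r = (2 * inverse 2) *s r"
      unfolding mult_2 vec.scale_left_distrib ..
    moreover have "2 * inverse 2 = (1::'a)" using two by simp
    ultimately show ?thesis by (metis diff_minus_eq_add vec.scale_one)
  qed
  then have "r \<in> range (\<lambda>t. t - flip t)" by (metis rangeI)
  then show ?thesis using comult_coboundary cybe_r by blast
qed

end
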